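(* There exist an absolute constant $c > 0$ and an admissible infinite strictly increasing sequence $A = \{a_1 < a_2 < \dots\}$ of squarefree positive integers which does not have property $Q$, and such that $a_j \ge \exp(c j^{1/2}/\log^{1/2} j)$ for all sufficiently large $j$.
   Context: $\mathrm{SF}$ denotes the set of squarefree positive integers. A set $A \subseteq \mathbb{N}$ is admissible if for each prime $p$ there is a residue class $b_p \pmod{p^2}$ containing no element of $A$. $A$ has property $Q$ if there are infinitely many $n \in \mathbb{N}$ such that $n + a \in \mathrm{SF}$ for all $a \in A$ with $a < n$. *)

theory Defs
  imports Complex_Main "HOL-Computational_Algebra.Squarefree" "HOL-Number_Theory.Cong"
begin

definition SF :: "nat set" where
  "SF = {n. n > 0 \<and> squarefree n}"

definition admissible :: "nat set \<Rightarrow> bool" where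
  "admissible A \<longleftrightarrow>
     (\<forall>p::nat. prime p \<longrightarrow> (\<exists>b::nat. \<forall>a\<in>A. \<not> [a = b] (mod p ^ 2)))"

definition property_Q :: "nat set \<Rightarrow> bool" where
  "property_Q A \<longleftrightarrow> infinite {n::nat. \<forall>a\<in>A. a < n \<longrightarrow> n + a \<in> SF}"

end

theory Submission imports Defs "HOL-Library.Infinite_Set"
begin

text \<open>
  A set of squarefree numbers avoids the class of 0 modulo every \<open>p\<^sup>2\<close>, so admissibility is automatic. Work at
  the doubly exponential scales \<open>X = 2 ^ L\<close> with \<open>L = 4 ^ h\<close>. For each \<open>n \<le> X ^ 4\<close> there are at least of
  order \<open>L / ln L\<close> primes \<open>p\<close> between \<open>sqrt L\<close> and \<open>64 L\<close> with \<open>p\<^sup>2\<close> not dividing \<open>n\<close>, by Chebyshev's lower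
  bound. Each of them makes \<open>n + a\<close> divisible by \<open>p\<^sup>2\<close> for a proportion of order \<open>1 / L\<^sup>2\<close> of the
  squarefree \<open>a \<le> X\<close>, and the overlaps between distinct primes are negligible. So a proportion \<open>\<delta>\<close> of order
  \<open>1 / (L ln L)\<close> of all \<open>a \<le> X\<close> are squarefree with \<open>n + a\<close> not squarefree, and a greedy choice of
  \<open>O(L / \<delta>) = O(L\<^sup>2 ln L)\<close> such \<open>a\<close> in \<open>(X ^ (1/4), X]\<close> spoils every \<open>n\<close> in \<open>(X, X ^ 4]\<close>. The union over all
  scales has \<open>O((log x)\<^sup>2 log log x)\<close> elements up to \<open>x\<close>, because the bounds grow geometrically in \<open>h\<close>.
\<close>

section \<open>Chebyshev's lower bound for the number of primes\<close>

text \<open>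
  Induction along Leibniz' harmonic triangle: with \<open>l n m = m * (n choose m)\<close> one has
  \<open>1 / l (n+1) m = 1 / l n m - 1 / l (n+1) (m+1)\<close>.
\<close>

lemma mult_binomial_dvd_common_multiple:
  fixes D :: nat
  assumes "\<And>k. 1 \<le> k \<Longrightarrow> k \<le> n \<Longrightarrow> k dvd D" and "1 \<le> m" and "m \<le> n"
  shows "m * (n choose m) dvd D"
  using assms
proof (induction n arbitrary: m)
  case 0
  then show ?case by simp
next
  case (Suc n)
  note IHn = Suc.IH and prems = Suc.prems
  \<comment> \<open>Downward induction along row \<open>n + 1\<close>: its last entry is
    \<open>n + 1\<close> itself, and the entry needed from row \<open>n\<close> comes from the outer
    induction.\<close>
  show ?case using \<open>m \<le> Suc n\<close> \<open>1 \<le> m\<close>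
  proof (induction m rule: inc_induct)
    case base
    then show ?case using prems(1)[of "Suc n"] by simp
  next
    case (step m)
    define d where "d = Suc n - m"
    have d: "d > 0" "Suc n = m + d" using step.hyps by (auto simp: d_def)
    have "Suc m * (Suc n choose Suc m) dvd D" using step by simp
    then obtain y where y: "D = Suc m * (Suc n choose Suc m) * y" by (auto elim: dvdE)
    have "m * (n choose m) dvd D" 
      by (rule IHn) (use prems(1) step in auto)
    then obtain x where x: "D = m * (n choose m) * x" by (auto elim: dvdE)
    have b: "Suc m * (Suc n choose Suc m) = d * (Suc n choose m)"
      by (metis binomial_absorb_comp binomial_absorption d_def diff_Suc_Suc)
    have c: "Suc n * (n choose m) = d * (Suc n choose m)"
      using b Suc_times_binomial by metis
    have 1: "d * (m * (Suc n choose m)) * x = Suc n * D"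
      unfolding x using c by (metis mult.assoc mult.left_commute)
    have 2: "d * (m * (Suc n choose m)) * y = m * D"
      unfolding y using b by (metis mult.assoc mult.left_commute)
    have "d * (m * (Suc n choose m) * (x - y)) = Suc n * D - m * D"
      using 1 2 by (metis diff_mult_distrib2 mult.assoc)
    also have "\<dots> = d * D" by (simp add: d_def diff_mult_distrib)
    finally have "m * (Suc n choose m) * (x - y) = D" using d by simp
    then show ?case by (metis dvd_triv_left)
  qed
qed

text \<open>\<open>m * (2m choose m)\<close> divides the least common multiple of 1, ...,
  \<open>2m\<close>. This multiple is a product of one prime power, each at most \<open>2m\<close>,
  for every prime up to \<open>2m\<close>, whereas the central binomial coefficient is at least
  \<open>4^m / (2m)\<close>.\<close>

lemma two_power_le_power_prime_count:
  assumes "m \<ge> 1"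
  shows "2 ^ m \<le> (2 * m) ^ card {p::nat. prime p \<and> p \<le> 2 * m}"
proof -
  define N where "N = 2 * m"
  define P where "P = {p::nat. prime p \<and> p \<le> N}"
  have finP: "finite P" unfolding P_def by (rule finite_subset[of _ "{..N}"]) auto
  define e where "e p = (GREATEST j. p ^ j \<le> N)" for p :: nat
  have e: "p ^ j \<le> N \<Longrightarrow> j \<le> e p" "p ^ e p \<le> N" if "p \<in> P" for p j
  proof -
    have bd: "\<forall>j. p ^ j \<le> N \<longrightarrow> j \<le> N"
    proof (intro allI impI)
      fix j assume "p ^ j \<le> N"
      moreover have "j < p ^ j" using that prime_gt_1_nat[of p] by (simp add: P_def power_gt_expt)
      ultimately show "j \<le> N" by simp
    qed
    show "p ^ j \<le> N \<Longrightarrow> j \<le> e p" unfolding e_def by (rule Greatest_le_nat[of _ j N]) (use bd in auto)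
    show "p ^ e p \<le> N" unfolding e_def
      by (rule GreatestI_nat[of "\<lambda>j. p ^ j \<le> N" 0 N]) (use bd assms in \<open>auto simp: N_def\<close>)
  qed
  \<comment> \<open>\<open>D\<close> is the least common multiple of 1, ..., \<open>N\<close>,
    assembled from the largest prime powers not exceeding \<open>N\<close>.\<close>
  define D where "D = (\<Prod>p\<in>P. p ^ e p)"
  have Dpos: "D > 0" unfolding D_def by (intro prod_pos) (auto simp: P_def prime_gt_0_nat)
  have dvd: "k dvd D" if k: "1 \<le> k" "k \<le> N" for k
  proof -
    have "k = (\<Prod>p\<in>prime_factors k. p ^ multiplicity p k)"
      using k by (intro prime_factorization_nat) auto
    also have "\<dots> dvd D" unfolding D_def
    proof (rule prod_dvd_prod_subset2[OF finP])
      show sub: "prime_factors k \<subseteq> P"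
        using k by (auto simp: P_def prime_factors_dvd dest: dvd_imp_le)
      fix p assume p: "p \<in> prime_factors k"
      have "p ^ multiplicity p k \<le> k"
        using k by (intro dvd_imp_le multiplicity_dvd) auto
      hence "multiplicity p k \<le> e p" using sub p k by (intro e) auto
      then show "p ^ multiplicity p k dvd p ^ e p" by (rule le_imp_power_dvd)
    qed
    finally show ?thesis .
  qed
  have "m * ((2*m) choose m) dvd D"
    by (rule mult_binomial_dvd_common_multiple) (use dvd assms in \<open>auto simp: N_def\<close>)
  hence le: "m * ((2*m) choose m) \<le> D" using Dpos by (rule dvd_imp_le)
  have "D \<le> (\<Prod>p\<in>P. N)" unfolding D_def by (intro prod_mono) (auto simp: e)
  hence D: "D \<le> N ^ card P" by simp
  have "(4::real) ^ m / (2 * real m) \<le> real ((2*m) choose m)"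
    using central_binomial_lower_bound[of m] assms by simp
  hence "(4::real) ^ m \<le> real (2 * (m * ((2*m) choose m)))"
    using assms by (simp add: field_simps)
  hence "4 ^ m \<le> 2 * (m * ((2*m) choose m))" by (metis of_nat_le_iff of_nat_numeral of_nat_power)
  moreover have "(4::nat) ^ m = 2 ^ m * 2 ^ m" by (simp flip: power_mult_distrib)
  \<comment> \<open>Of the two factors in \<open>4^m = 2^m * 2^m\<close>, one is given up to absorb
    the stray 2.\<close>
  moreover have "(2::nat) * 2 ^ m \<le> 2 ^ m * 2 ^ m"
    using assms self_le_power[of "2::nat" m] by (intro mult_right_mono) auto
  ultimately have "2 * 2 ^ m \<le> 2 * (m * ((2*m) choose m))" by linarith
  hence "2 ^ m \<le> N ^ card P" using le D by linarith
  then show ?thesis by (simp only: N_def P_def)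
qed

section \<open>Greedy covering\<close>

text \<open>By double counting, some \<open>a\<close> in \<open>V\<close> is related to a proportion
  of at least \<open>\<delta>\<close> of the points of \<open>U\<close> still missed. Adding it to
  \<open>S\<close> multiplies the number of missed points by at most
  \<open>1 - \<delta>\<close>.\<close>

lemma greedy_cover:
  fixes U :: "'a set" and V :: "'b set" and \<delta> :: real
  assumes "finite U" "finite V" "V \<noteq> {}"
    and deg: "\<And>n. n \<in> U \<Longrightarrow> \<delta> * card V \<le> card {a \<in> V. R n a}"
    and \<delta>: "0 \<le> \<delta>" "\<delta> \<le> 1"
  shows "\<exists>S\<subseteq>V. card S \<le> t \<and> card {n \<in> U. \<forall>a\<in>S. \<not> R n a} \<le> (1 - \<delta>) ^ t * card U"
proof (induction t)
  case 0
  show ?case by (rule exI[of _ "{}"]) auto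
next
  case (Suc t)
  then obtain S where S: "S \<subseteq> V" "card S \<le> t"
    and le: "card {n \<in> U. \<forall>a\<in>S. \<not> R n a} \<le> (1 - \<delta>) ^ t * card U" by auto
  define W where "W = {n \<in> U. \<forall>a\<in>S. \<not> R n a}"
  have finW: "finite W" unfolding W_def using assms by auto
  have "\<exists>T\<subseteq>V. card T \<le> Suc t \<and> card {n \<in> U. \<forall>a\<in>T. \<not> R n a} \<le> (1 - \<delta>) * card W"
  proof -
    have sum: "(\<Sum>a\<in>V. card {n\<in>W. R n a}) = (\<Sum>n\<in>W. card {a\<in>V. R n a})"
      using assms finW by (intro sum_multicount_gen) auto
    have "\<exists>a\<in>V. \<delta> * card W \<le> card {n \<in> W. R n a}"
    proof (rule ccontr)
      assume "\<not> ?thesis"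
      hence "(\<Sum>a\<in>V. real (card {n\<in>W. R n a})) < (\<Sum>a\<in>V. \<delta> * card W)"
        using assms by (intro sum_strict_mono) auto
      also have "\<dots> = (\<Sum>n\<in>W. \<delta> * card V)" by simp
      also have "\<dots> \<le> (\<Sum>n\<in>W. real (card {a\<in>V. R n a}))"
        using deg by (intro sum_mono) (auto simp: W_def)
      finally show False using arg_cong[OF sum, of real] by simp
    qed
    then obtain a where a: "a \<in> V" "\<delta> * card W \<le> card {n \<in> W. R n a}" by blast
    have eq: "{n \<in> U. \<forall>b\<in>insert a S. \<not> R n b} = W - {n \<in> W. R n a}" by (auto simp: W_def)
    have "real (card (W - {n \<in> W. R n a})) = real (card W) - real (card {n \<in> W. R n a})"
      using finW by (subst card_Diff_subset) (auto intro!: of_nat_diff card_mono)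
    also have "\<dots> \<le> (1 - \<delta>) * card W" using a by (simp add: algebra_simps)
    finally have "card {n \<in> U. \<forall>b\<in>insert a S. \<not> R n b} \<le> (1 - \<delta>) * card W" by (simp only: eq)
    moreover have "card (insert a S) \<le> Suc t"
      using S by (metis card_insert_le_m1 diff_Suc_1 zero_less_Suc)
    ultimately show ?thesis using a S by (intro exI[of _ "insert a S"]) auto
  qed
  then obtain T where T: "T \<subseteq> V" "card T \<le> Suc t"
    "card {n \<in> U. \<forall>a\<in>T. \<not> R n a} \<le> (1 - \<delta>) * card W" by blast
  note T(3)
  also have "(1 - \<delta>) * card W \<le> (1 - \<delta>) * ((1 - \<delta>) ^ t * card U)"
    using le \<delta> by (intro mult_left_mono) (auto simp: W_def)
  finally show ?case using T by (auto simp: mult.assoc)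
qed

section \<open>Counting residue classes in intervals\<close>

lemma card_cong_interval_eq:
  fixes u m r k :: nat
  assumes "m > 0"
  shows "card {a \<in> {u<..u + k * m}. [a = r] (mod m)} = k"
proof -
  have one: "card {a \<in> {v<..v + m}. [a = r] (mod m)} = 1" for v
  proof -
    have "\<exists>!a. a \<in> {v<..v + m} \<and> [a = r] (mod m)"
    proof -
      \<comment> \<open>\<open>s\<close> is the residue of \<open>r - (v + 1)\<close>; the factor
        \<open>m - 1\<close> plays the role of -1 within the natural numbers.\<close>
      define s where "s = (r + (m - 1) * (v + 1)) mod m"
      have s: "s < m" using assms by (simp add: s_def)
      have "[v + 1 + s = v + 1 + (r + (m - 1) * (v + 1))] (mod m)"
        unfolding s_def cong_def by (rule mod_add_right_eq)
      also have "v + 1 + (r + (m - 1) * (v + 1)) = r + m * (v + 1)"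
        using assms by (cases m) auto
      also have "[r + m * (v + 1) = r] (mod m)"
        unfolding cong_def by (rule mod_mult_self2)
      finally have "[v + 1 + s = r] (mod m)" .
      moreover have eq: "a = b" if "a \<in> {v<..v + m}" "b \<in> {v<..v + m}" "[a = r] (mod m)" "[b = r] (mod m)" "a \<le> b" for a b
      proof -
        have "[b = a] (mod m)" using that by (metis cong_sym cong_trans)
        hence "m dvd b - a" using \<open>a \<le> b\<close> cong_altdef_nat by blast
        moreover have "b - a < m" using that by auto
        ultimately have "b - a = 0" by (metis dvd_imp_le gr0I linorder_not_less)
        then show ?thesis using that by simp
      qed
      moreover have "a = b" if "a \<in> {v<..v + m}" "b \<in> {v<..v + m}" "[a = r] (mod m)" "[b = r] (mod m)" for a b
        using eq[of a b] eq[of b a] that by (cases "a \<le> b") auto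
      moreover have "v + 1 + s \<in> {v<..v + m}" using s by simp
      ultimately show ?thesis by blast
    qed
    then obtain a where "{a \<in> {v<..v + m}. [a = r] (mod m)} = {a}" by blast
    then show ?thesis by simp
  qed
  show ?thesis
  proof (induction k)
    case 0
    then show ?case by simp
  next
    case (Suc k)
    have "{a \<in> {u<..u + Suc k * m}. [a = r] (mod m)} =
       {a \<in> {u<..u + k * m}. [a = r] (mod m)} \<union> {a \<in> {u + k * m<..(u + k * m) + m}. [a = r] (mod m)}"
      by auto
    also have "card \<dots> = k + 1"
      using one[of "u + k * m"] Suc by (subst card_Un_disjoint) auto
    finally show ?case by simp
  qed
qed

lemma card_cong_interval_ge:
  fixes u v m r :: nat
  assumes "m > 0" "u \<le> v"
  shows "(real v - real u) / m - 1 \<le> card {a \<in> {u<..v}. [a = r] (mod m)}"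
proof -
  define k where "k = (v - u) div m"
  have "k * m \<le> v - u" by (simp add: k_def)
  hence "{a \<in> {u<..u + k * m}. [a = r] (mod m)} \<subseteq> {a \<in> {u<..v}. [a = r] (mod m)}"
    using assms by auto
  from card_mono[OF _ this] have "k \<le> card {a \<in> {u<..v}. [a = r] (mod m)}"
    by (simp only: card_cong_interval_eq[OF assms(1)]) simp
  moreover have "real (v - u) / m - 1 \<le> k"
  proof -
    have "v - u < m * (k + 1)" using assms(1) unfolding k_def
      by (metis Suc_eq_plus1 dividend_less_times_div mult_Suc_right)
    hence "real (v - u) < real m * (real k + 1)"
      by (metis of_nat_1 of_nat_add of_nat_less_iff of_nat_mult)
    then show ?thesis using assms(1) by (simp add: field_simps)
  qed
  ultimately show ?thesis using assms by (simp add: of_nat_diff)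
qed

text \<open>Pairwise congruence in place of a prescribed residue avoids computing the residue, which
  for \<open>m = p^2 * q^2\<close> would require solving a system of congruences.\<close>

lemma card_pairwise_cong_le:
  fixes v m :: nat
  assumes "m > 0" "A \<subseteq> {0<..v}" and "\<And>a b. a \<in> A \<Longrightarrow> b \<in> A \<Longrightarrow> [a = b] (mod m)"
  shows "card A \<le> real v / m + 1"
proof (cases "A = {}")
  case False
  then obtain r where r: "r \<in> A" by blast
  define k where "k = v div m + 1"
  have "v < m * k" using assms(1) unfolding k_def
    by (metis Suc_eq_plus1 dividend_less_times_div mult_Suc_right)
  hence "A \<subseteq> {a \<in> {0<..0 + k * m}. [a = r] (mod m)}"
    using assms(2) assms(3)[OF _ r] by (auto simp: mult.commute subset_iff intro: order.trans less_imp_le)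
  from card_mono[OF _ this] have "card A \<le> k"
    by (simp only: card_cong_interval_eq[OF assms(1)]) simp
  then show ?thesis unfolding k_def using of_nat_div_le_of_nat[of v m, where ?'a = real] by linarith
qed auto

section \<open>Sums of inverse squares\<close>

text \<open>Telescoping with \<open>1/m^2 <= 1/(m-1) - 1/m\<close>.\<close>

lemma sum_inverse_squares_le:
  fixes M :: "nat set"
  assumes "finite M" "M \<subseteq> {s<..}" "s \<ge> 1"
  shows "(\<Sum>m\<in>M. 1 / (real m)\<^sup>2) \<le> 1 / s"
proof -
  have tel: "(\<Sum>m\<in>{s<..s+k}. 1 / (real m)\<^sup>2) \<le> 1 / s - 1 / (s + k)" for k
  proof (induction k)
    case (Suc k)
    have "{s<..s + Suc k} = insert (s + Suc k) {s<..s+k}" by auto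
    moreover have "1 / (real (s + Suc k))\<^sup>2 \<le> 1 / real (s + k) - 1 / real (s + Suc k)"
      using assms(3) by (simp add: divide_simps power2_eq_square)
    ultimately show ?case using Suc by simp
  qed auto
  have "M \<subseteq> {s<..s + Max (insert 0 M)}" 
  proof
    fix x assume x: "x \<in> M"
    hence "x \<le> Max (insert 0 M)" using assms(1) by (intro Max_ge) auto
    then show "x \<in> {s<..s + Max (insert 0 M)}" using assms(2) x by auto
  qed
  hence "(\<Sum>m\<in>M. 1 / (real m)\<^sup>2) \<le> (\<Sum>m\<in>{s<..s + Max (insert 0 M)}. 1 / (real m)\<^sup>2)"
    by (intro sum_mono2) auto
  also have "\<dots> \<le> 1 / s" using tel[of "Max (insert 0 M)"] by (smt (verit) divide_nonneg_nonneg of_nat_0_le_iff)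
  finally show ?thesis .
qed

text \<open>The prime 2 contributes 1/4, and all integers beyond 2 together at most 1/2. As the
  bound is below 1, a quarter of a residue class modulo \<open>p^2\<close> survives sieving by the
  squares of the other primes.\<close>

lemma sum_inverse_prime_squares_le:
  fixes M :: "nat set"
  assumes "finite M" "\<And>p. p \<in> M \<Longrightarrow> prime p"
  shows "(\<Sum>p\<in>M. 1 / (real p)\<^sup>2) \<le> 3 / 4"
proof -
  have "(\<Sum>p\<in>M. 1 / (real p)\<^sup>2) \<le> (\<Sum>p\<in>insert 2 (M - {2}). 1 / (real p)\<^sup>2)"
    using assms by (intro sum_mono2) auto
  also have "\<dots> = 1/4 + (\<Sum>p\<in>M - {2}. 1 / (real p)\<^sup>2)"
    using assms(1) by (subst sum.insert) simp_all
  also have "(\<Sum>p\<in>M - {2}. 1 / (real p)\<^sup>2) \<le> 1 / real 2"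
  proof (rule sum_inverse_squares_le)
    show "M - {2} \<subseteq> {2<..}"
    proof
      fix p assume "p \<in> M - {2}"
      then show "p \<in> {2<..}" using prime_ge_2_nat[OF assms(2)[of p]] by simp
    qed
  qed (use assms(1) in simp_all)
  finally show ?thesis by simp
qed

section \<open>Primes whose squares do not divide n\<close>

lemma prod_prime_squares_dvd:
  fixes n :: nat
  assumes "finite P" "\<And>p. p \<in> P \<Longrightarrow> prime p \<and> p\<^sup>2 dvd n"
  shows "(\<Prod>p\<in>P. p\<^sup>2) dvd n"
  using assms
proof (induction P)
  case (insert q P)
  have "coprime (q\<^sup>2) (\<Prod>p\<in>P. p\<^sup>2)"
    using insert by (intro prod_coprime_right) (auto intro!: primes_coprime)
  with insert show ?case by (auto intro: divides_mult)
qed auto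

text \<open>With \<open>L = 4^h\<close> there are at least \<open>8L/h\<close> primes up to
  \<open>64L\<close>. At most \<open>2^h <= L/h\<close> of them are small, and at most
  \<open>2L/h\<close> of the others have squares dividing \<open>n\<close>, since the product of
  these squares is at most \<open>n <= 2^(4L)\<close>. This leaves \<open>5L/h\<close>.\<close>

lemma card_large_primes_square_not_dvd:
  fixes n h :: nat
  assumes "h \<ge> 3" "0 < n" "n \<le> 2 ^ (4 * 4 ^ h)"
  defines "P \<equiv> {p. prime p \<and> 2 ^ h < p \<and> p \<le> 64 * 4 ^ h \<and> \<not> p\<^sup>2 dvd n}"
  shows "5 * 4 ^ h \<le> h * card P"
proof -
  define L :: nat where "L = 4 ^ h"
  define B where "B = {p. prime p \<and> 2 ^ h < p \<and> p \<le> 64 * L \<and> p\<^sup>2 dvd n}"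
  define A where "A = {p::nat. prime p \<and> p \<le> 64 * L}"
  have "finite A" unfolding A_def by (rule finite_subset[of _ "{..64 * L}"]) auto
  moreover have "A \<subseteq> {0<..2 ^ h} \<union> B \<union> P"
    by (auto simp: A_def B_def P_def L_def prime_gt_0_nat)
  moreover have fin: "finite B" "finite P"
    using \<open>finite A\<close> by (auto simp: A_def B_def P_def L_def elim: rev_finite_subset)
  ultimately have "card A \<le> card ({0<..2 ^ h} \<union> B \<union> P)" by (intro card_mono) auto
  also have "\<dots> \<le> card {0<..(2::nat) ^ h} + card B + card P"
    by (metis add_le_mono1 card_Un_le order_trans)
  finally have A_le: "card A \<le> 2 ^ h + card B + card P" by simp
  \<comment> \<open>The base \<open>64 * L\<close> is \<open>2^(2h+6)\<close>, and
    \<open>2h + 6 <= 4h\<close> because \<open>h >= 3\<close>.\<close>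
  have "2 ^ (32 * L) \<le> (2 * (32 * L)) ^ card {p::nat. prime p \<and> p \<le> 2 * (32 * L)}"
    by (rule two_power_le_power_prime_count) (simp add: L_def)
  also have "{p::nat. prime p \<and> p \<le> 2 * (32 * L)} = A" by (simp add: A_def)
  also have "2 * (32 * L) = 2 ^ (2 * h + 6)" by (simp add: L_def power_add power_mult)
  also have "(2 ^ (2 * h + 6)) ^ card A = (2::nat) ^ ((2 * h + 6) * card A)" by (simp only: power_mult)
  finally have "32 * L \<le> (2 * h + 6) * card A" by (simp del: power_mult)
  also have "\<dots> \<le> (4 * h) * card A" using assms by (intro mult_right_mono) auto
  finally have A_ge: "8 * L \<le> h * card A" by simp
  have "(2::nat) ^ (2 * h * card B) = (\<Prod>p\<in>B. (2 ^ h)\<^sup>2)"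
    by (simp flip: power_mult add: mult_ac)
  also have "\<dots> \<le> (\<Prod>p\<in>B. p\<^sup>2)" 
    by (intro prod_mono conjI power_mono) (auto simp: B_def)
  also have "\<dots> \<le> n"
  proof (rule dvd_imp_le)
    show "(\<Prod>p\<in>B. p\<^sup>2) dvd n" using fin(1) by (rule prod_prime_squares_dvd) (simp add: B_def)
  qed (use assms in simp)
  also have "\<dots> \<le> 2 ^ (4 * L)" using assms by (simp add: L_def)
  finally have B_le: "h * card B \<le> 2 * L" by simp
  have "h * 2 ^ h \<le> 2 ^ h * 2 ^ h" by (intro mult_right_mono) auto
  also have "\<dots> = L" by (simp add: L_def flip: power_mult_distrib)
  finally have h: "h * 2 ^ h \<le> L" .
  have "h * card A \<le> h * 2 ^ h + h * card B + h * card P"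
    using mult_le_mono2[OF A_le, of h] by (simp add: distrib_left)
  then show ?thesis using A_ge B_le h unfolding L_def by linarith
qed

section \<open>Sieving a residue class modulo the square of a prime\<close>

text \<open>
  Forbidding the squares of the other primes of \<open>P\<close> makes the sets \<open>E\<close> disjoint for distinct \<open>p\<close>, so
  that their cardinalities can be added. When \<open>p\<^sup>2\<close> does not divide \<open>n\<close>, every element of \<open>E\<close> is squarefree.
\<close>

lemma card_exclusive_square_divisor_ge:
  fixes n u v r s p :: nat
  assumes "finite P" and P: "\<And>q. q \<in> P \<Longrightarrow> prime q \<and> s < q"
    and "p \<in> P" "s \<ge> 1" "u \<le> v" "v \<le> r\<^sup>2"
  defines "E \<equiv> {a \<in> {u<..v}. p\<^sup>2 dvd n + a \<and> (\<forall>q. prime q \<and> q \<noteq> p \<longrightarrow> \<not> q\<^sup>2 dvd a) \<and>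
              (\<forall>q\<in>P - {p}. \<not> q\<^sup>2 dvd n + a)}"
  shows "v / (real p)\<^sup>2 * (1/4 - 1/s) - (u + 1 + r + card P) \<le> card E"
proof -
  have p: "prime p" "p > 0" using P[OF \<open>p \<in> P\<close>] by (auto simp: prime_gt_0_nat)
  define B where "B = {a \<in> {u<..v}. p\<^sup>2 dvd n + a}"
  \<comment> \<open>Primes up to \<open>r\<close> suffice here, since \<open>q^2 dvd a\<close> and
    \<open>a <= v <= r^2\<close> force \<open>q <= r\<close>.\<close>
  define Q where "Q = {q. prime q \<and> q \<noteq> p \<and> q \<le> r}"
  define F where "F q = {a \<in> B. q\<^sup>2 dvd a}" for q
  define G where "G q = {a \<in> B. q\<^sup>2 dvd n + a}" for q
  have finQ: "finite Q" unfolding Q_def by (rule finite_subset[of _ "{..r}"]) auto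
  have finB: "finite B" by (auto simp: B_def)
  have cardQ: "card Q \<le> r"
  proof -
    have "Q \<subseteq> {0<..r}" by (auto simp: Q_def prime_gt_0_nat)
    from card_mono[OF _ this] show ?thesis by simp
  qed
  have Bcong: "[a = b] (mod p\<^sup>2)" if "a \<in> B" "b \<in> B" for a b
  proof -
    have "[n + a = n + b] (mod p\<^sup>2)" using that by (simp add: B_def cong_def mod_eq_0_iff_dvd)
    then show ?thesis by (simp add: cong_add_lcancel_nat)
  qed
  \<comment> \<open>All of \<open>C\<close> lies in one class modulo \<open>p^2 * q^2\<close>, by
    coprimality. This serves both for \<open>q^2\<close> dividing \<open>a\<close> and for
    \<open>q^2\<close> dividing \<open>n + a\<close>.\<close>
  have bound: "card C \<le> v / (real p)\<^sup>2 * (1 / (real q)\<^sup>2) + 1"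
    if q: "prime q" "q \<noteq> p" and C: "C \<subseteq> B" "\<And>a b. a \<in> C \<Longrightarrow> b \<in> C \<Longrightarrow> [a = b] (mod q\<^sup>2)" for q C
  proof -
    have cop: "coprime (p\<^sup>2) (q\<^sup>2)" using p q by (simp add: primes_coprime)
    have "card C \<le> real v / real (p\<^sup>2 * q\<^sup>2) + 1"
    proof (rule card_pairwise_cong_le)
      show "0 < p\<^sup>2 * q\<^sup>2" using p q by (simp add: prime_gt_0_nat)
      show "C \<subseteq> {0<..v}" using C by (auto simp: B_def)
      fix a b assume ab: "a \<in> C" "b \<in> C"
      show "[a = b] (mod p\<^sup>2 * q\<^sup>2)"
        by (rule coprime_cong_mult_nat[OF Bcong C(2)[OF ab] cop]) (use ab C(1) in auto)
    qed
    then show ?thesis by simp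
  qed
  have F: "card (F q) \<le> v / (real p)\<^sup>2 * (1 / (real q)\<^sup>2) + 1" if "q \<in> Q" for q
    by (rule bound) (use that in \<open>auto simp: Q_def F_def cong_def mod_eq_0_iff_dvd\<close>)
  have G: "card (G q) \<le> v / (real p)\<^sup>2 * (1 / (real q)\<^sup>2) + 1" if "q \<in> P - {p}" for q
  proof (rule bound)
    fix a b assume "a \<in> G q" "b \<in> G q"
    hence "[n + a = n + b] (mod q\<^sup>2)" by (simp add: G_def cong_def mod_eq_0_iff_dvd)
    then show "[a = b] (mod q\<^sup>2)" by (simp add: cong_add_lcancel_nat)
  qed (use that P in \<open>auto simp: G_def\<close>)
  have sumbound: "(\<Sum>q\<in>T. v / (real p)\<^sup>2 * (1 / (real q)\<^sup>2) + 1) \<le> v / (real p)\<^sup>2 * c + card T"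
    if "(\<Sum>q\<in>T. 1 / (real q)\<^sup>2) \<le> c" for c and T :: "nat set"
    using mult_left_mono[OF that, of "v / (real p)\<^sup>2"] by (simp add: sum.distrib sum_distrib_left)
  have "card (\<Union>q\<in>Q. F q) \<le> (\<Sum>q\<in>Q. card (F q))" by (rule card_UN_le[OF finQ])
  also have "real \<dots> \<le> (\<Sum>q\<in>Q. v / (real p)\<^sup>2 * (1 / (real q)\<^sup>2) + 1)"
    unfolding of_nat_sum by (rule sum_mono[OF F])
  also have "\<dots> \<le> v / (real p)\<^sup>2 * (3/4) + card Q"
    by (intro sumbound sum_inverse_prime_squares_le finQ) (auto simp: Q_def)
  finally have F_le: "card (\<Union>q\<in>Q. F q) \<le> v / (real p)\<^sup>2 * (3/4) + r" using cardQ by simp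
  have "card (\<Union>q\<in>P - {p}. G q) \<le> (\<Sum>q\<in>P - {p}. card (G q))" using assms(1) by (intro card_UN_le) auto
  also have "real \<dots> \<le> (\<Sum>q\<in>P - {p}. v / (real p)\<^sup>2 * (1 / (real q)\<^sup>2) + 1)"
    unfolding of_nat_sum by (rule sum_mono[OF G])
  also have "\<dots> \<le> v / (real p)\<^sup>2 * (1 / s) + card (P - {p})"
    by (intro sumbound sum_inverse_squares_le) (use assms in auto)
  also have "card (P - {p}) \<le> card P" using assms(1) by (intro card_mono) auto
  finally have G_le: "card (\<Union>q\<in>P - {p}. G q) \<le> v / (real p)\<^sup>2 * (1 / s) + card P" by simp
  have "B \<subseteq> E \<union> (\<Union>q\<in>Q. F q) \<union> (\<Union>q\<in>P - {p}. G q)"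
  proof
    fix a assume a: "a \<in> B"
    have "q \<in> Q" if "prime q" "q \<noteq> p" "q\<^sup>2 dvd a" for q
    proof -
      have "q\<^sup>2 \<le> a" using that(3) a by (intro dvd_imp_le) (auto simp: B_def)
      also have "\<dots> \<le> r\<^sup>2" using a assms by (auto simp: B_def)
      finally have "q \<le> r" by (simp add: power2_nat_le_eq_le)
      then show ?thesis using that by (simp add: Q_def)
    qed
    then show "a \<in> E \<union> (\<Union>q\<in>Q. F q) \<union> (\<Union>q\<in>P - {p}. G q)"
      using a unfolding E_def F_def G_def B_def by blast
  qed
  hence "card B \<le> card (E \<union> (\<Union>q\<in>Q. F q) \<union> (\<Union>q\<in>P - {p}. G q))"
    using finQ finB assms(1) by (intro card_mono) (auto simp: E_def F_def G_def)
  also have "\<dots> \<le> card E + card (\<Union>q\<in>Q. F q) + card (\<Union>q\<in>P - {p}. G q)"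
    by (metis add_le_mono1 card_Un_le order_trans)
  finally have B_le: "card B \<le> card E + card (\<Union>q\<in>Q. F q) + card (\<Union>q\<in>P - {p}. G q)" .
  \<comment> \<open>The class of \<open>-n\<close> modulo \<open>p^2\<close>, with the
    representative \<open>n * (p^2 - 1)\<close>.\<close>
  have "B = {a \<in> {u<..v}. [a = n * (p\<^sup>2 - 1)] (mod p\<^sup>2)}"
  proof -
    have "p\<^sup>2 dvd n + a \<longleftrightarrow> [a = n * (p\<^sup>2 - 1)] (mod p\<^sup>2)" for a
    proof -
      have "[a = n * (p\<^sup>2 - 1)] (mod p\<^sup>2) \<longleftrightarrow> [n + a = n + n * (p\<^sup>2 - 1)] (mod p\<^sup>2)"
        by (simp add: cong_add_lcancel_nat)
      also have "n + n * (p\<^sup>2 - 1) = n * p\<^sup>2" using p by (cases "p\<^sup>2") auto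
      finally show ?thesis by (simp add: cong_def mod_eq_0_iff_dvd)
    qed
    then show ?thesis by (simp add: B_def)
  qed
  hence "(real v - real u) / (real p)\<^sup>2 - 1 \<le> card B"
    using card_cong_interval_ge[of "p\<^sup>2" u v] p assms by simp
  moreover have "real u / (real p)\<^sup>2 \<le> u"
    using p by (simp add: divide_le_eq mult_le_cancel_left1)
  ultimately have "v / (real p)\<^sup>2 - u - 1 \<le> card B" by (simp add: diff_divide_distrib)
  with B_le F_le G_le show ?thesis by (simp add: algebra_simps)
qed

section \<open>Density of the squarefree a that spoil a given n\<close>

text \<open>Makes the sieve errors negligible: the factor 2048 is dictated by
  \<open>16 * (256 M)^2 * 4 = (2048 M)^2\<close>. At \<open>M = 16\<close> the claim reads
  \<open>2^15 <= 2^16\<close>.\<close>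

lemma linear_le_two_power:
  assumes "M \<ge> (16::nat)" shows "2048 * M \<le> 2 ^ M"
  using assms
proof (induction M rule: dec_induct)
  case (step m)
  then show ?case by simp
qed simp

text \<open>At least \<open>20 M / (k + 1)\<close> primes, where \<open>M = 4^k\<close>, contribute
  disjoint sets, each of at least \<open>v / (8 * (256 M)^2)\<close> numbers up to
  \<open>v = 2^(4M)\<close>.\<close>

lemma card_squarefree_nonsquarefree_translate_ge:
  fixes n k :: nat
  assumes "k \<ge> 3" "0 < n" "n \<le> 2 ^ (16 * 4 ^ k)"
  shows "2 ^ (4 * 4 ^ k) / (32768 * 4 ^ k * real (Suc k)) \<le>
     real (card {a \<in> {2 ^ 4 ^ k<..2 ^ (4 * 4 ^ k)}. squarefree a \<and> \<not> squarefree (n + a)})"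
proof -
  \<comment> \<open>The scale is \<open>L = 4 * M\<close> and \<open>X = v\<close>. Then
    \<open>u\<close> is the fourth root of \<open>X\<close>, \<open>r\<close> the square root of
    \<open>X\<close> and \<open>s\<close> the square root of \<open>L\<close>.\<close>
  define M :: nat where "M = 4 ^ k"
  define u :: nat where "u = 2 ^ M"
  define v :: nat where "v = 2 ^ (4 * M)"
  define r :: nat where "r = 2 ^ (2 * M)"
  define s :: nat where "s = 2 ^ Suc k"
  define P where "P = {p. prime p \<and> s < p \<and> p \<le> 256 * M \<and> \<not> p\<^sup>2 dvd n}"
  define E where "E p = {a \<in> {u<..v}. p\<^sup>2 dvd n + a \<and> (\<forall>q. prime q \<and> q \<noteq> p \<longrightarrow> \<not> q\<^sup>2 dvd a) \<and>
              (\<forall>q\<in>P - {p}. \<not> q\<^sup>2 dvd n + a)}" for p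
  have "(4::nat) ^ 3 \<le> 4 ^ k" using assms by (intro power_increasing) auto
  hence M: "M \<ge> 16" by (simp add: M_def)
  note M2 = linear_le_two_power[OF M]
  have "(2::nat) ^ 4 \<le> 2 ^ Suc k" using assms by (intro power_increasing) auto
  hence s: "s \<ge> 16" by (simp add: s_def)
  have "P \<subseteq> {0<..256 * M}" by (auto simp: P_def prime_gt_0_nat)
  from card_mono[OF _ this] finite_subset[OF this] have finP: "finite P" and cardP: "card P \<le> 256 * M" by auto
  have "5 * 4 ^ Suc k \<le> Suc k * card {p. prime p \<and> 2 ^ Suc k < p \<and> p \<le> 64 * 4 ^ Suc k \<and> \<not> p\<^sup>2 dvd n}"
    by (rule card_large_primes_square_not_dvd) (use assms in auto)
  also have "{p. prime p \<and> 2 ^ Suc k < p \<and> p \<le> 64 * 4 ^ Suc k \<and> \<not> p\<^sup>2 dvd n} = P"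
    by (simp add: P_def s_def M_def)
  finally have P_ge: "20 * M \<le> Suc k * card P" by (simp add: M_def)
  have v_eq: "v = r\<^sup>2" "r = u\<^sup>2" by (simp_all add: v_def r_def u_def flip: power_mult)
  have "16 * (256 * M)\<^sup>2 * (4 * r) = (2048 * M)\<^sup>2 * r" by (simp add: power2_eq_square)
  also have "\<dots> \<le> (2 ^ M)\<^sup>2 * r" using M2 by (intro mult_right_mono power_mono) auto
  also have "\<dots> = v" by (simp add: v_eq power2_eq_square flip: u_def)
  finally have err: "16 * (256 * M)\<^sup>2 * (4 * r) \<le> v" .
  have u1: "u \<ge> 1" by (simp add: u_def)
  have "u + 1 + r + card P \<le> 4 * r"
  proof -
    have "u * 1 \<le> u * u" using u1 by (intro mult_left_mono) auto
    moreover have "card P \<le> u" using cardP M2 unfolding u_def by linarith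
    ultimately show ?thesis using u1 unfolding v_eq power2_eq_square by linarith
  qed
  hence err2: "16 * (256 * M)\<^sup>2 * (u + 1 + r + card P) \<le> v"
    using err by (meson le_trans mult_le_mono2)
  have E_ge: "v / (8 * (256 * real M)\<^sup>2) \<le> card (E p)" if p: "p \<in> P" for p
  proof -
    have p0: "0 < p" "p \<le> 256 * M" using p by (auto simp: P_def prime_gt_0_nat)
    hence "16 * p\<^sup>2 * (u + 1 + r + card P) \<le> 16 * (256 * M)\<^sup>2 * (u + 1 + r + card P)"
      by (intro mult_right_mono mult_left_mono power_mono) auto
    also note err2
    finally have "real (16 * p\<^sup>2 * (u + 1 + r + card P)) \<le> v" by (rule of_nat_mono)
    hence e: "real (u + 1 + r + card P) \<le> v / (real p)\<^sup>2 * (1/16)"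
      using p0 by (simp add: pos_le_divide_eq algebra_simps)
    \<comment> \<open>From \<open>s >= 16\<close> the main term keeps 3/16 of
      \<open>v / p^2\<close>; the error terms cost at most another 1/16, leaving 1/8.\<close>
    have "v / (real p)\<^sup>2 * (3/16) \<le> v / (real p)\<^sup>2 * (1/4 - 1/s)"
    proof (rule mult_left_mono)
      show "3/16 \<le> 1/4 - 1 / real s" using s by (simp add: divide_simps)
    qed simp
    moreover have "v / (real p)\<^sup>2 * (1/4 - 1/s) - (u + 1 + r + card P) \<le> card (E p)"
      unfolding E_def
    proof (rule card_exclusive_square_divisor_ge)
      show "prime q \<and> s < q" if "q \<in> P" for q using that by (simp add: P_def)
      show "v \<le> r\<^sup>2" by (simp add: v_eq)
      show "u \<le> v" by (simp add: u_def v_def)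
    qed (use finP p s in auto)
    ultimately have "v / (real p)\<^sup>2 * (1/8) \<le> card (E p)" using e by simp
    moreover have "v / (8 * (256 * real M)\<^sup>2) \<le> v / (8 * (real p)\<^sup>2)"
    proof (intro divide_left_mono mult_left_mono power_mono)
      show "real p \<le> 256 * real M" using p0(2) by linarith
    qed (use p0 M in auto)
    ultimately show ?thesis by simp
  qed
  have disj: "E p \<inter> E q = {}" if "p \<in> P" "q \<in> P" "p \<noteq> q" for p q
    using that by (auto simp: E_def)
  have sub: "(\<Union>p\<in>P. E p) \<subseteq> {a \<in> {u<..v}. squarefree a \<and> \<not> squarefree (n + a)}"
  proof clarify
    fix p a assume p: "p \<in> P" and a: "a \<in> E p"
    have "\<not> p\<^sup>2 dvd a" using p a by (auto simp: P_def E_def dvd_add_left_iff)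
    hence "\<not> q\<^sup>2 dvd a" if "prime q" for q using that a by (cases "q = p") (auto simp: E_def)
    moreover have "a > 0" using a by (auto simp: E_def)
    ultimately have "squarefree a" by (simp add: squarefree_factorial_semiring)
    moreover have "\<not> squarefree (n + a)"
      using p a by (intro not_squarefreeI[of p]) (auto simp: P_def E_def)
    ultimately show "a \<in> {u<..v} \<and> squarefree a \<and> \<not> squarefree (n + a)"
      using a by (auto simp: E_def)
  qed
  \<comment> \<open>Since \<open>8 * 256^2 = 16 * 32768\<close>, the 20 from the prime count exceeds
    the 16 required; the slack is dropped here.\<close>
  have "v / (32768 * real M * Suc k) \<le> 20/16 * (v / (32768 * real M * Suc k))"
  proof -
    have *: "x \<le> 20/16 * x" if "x \<ge> 0" for x :: real using that by simp
    show ?thesis by (rule *) simp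
  qed
  also have "\<dots> = (20 * M / Suc k) * (v / (8 * (256 * real M)\<^sup>2))"
    using M by (simp add: power2_eq_square del: of_nat_Suc)
  also have "\<dots> \<le> card P * (v / (8 * (256 * real M)\<^sup>2))"
  proof (rule mult_right_mono)
    have "real (20 * M) \<le> real (Suc k * card P)" using P_ge by (rule of_nat_mono)
    then show "20 * M / Suc k \<le> real (card P)" by (simp add: divide_le_eq algebra_simps)
  qed auto
  also have "\<dots> = (\<Sum>p\<in>P. v / (8 * (256 * real M)\<^sup>2))" by simp
  also have "\<dots> \<le> (\<Sum>p\<in>P. real (card (E p)))" by (rule sum_mono[OF E_ge])
  also have "\<dots> = card (\<Union>p\<in>P. E p)"
    using finP disj by (subst card_UN_disjoint) (auto simp: E_def)
  also have "\<dots> \<le> card {a \<in> {u<..v}. squarefree a \<and> \<not> squarefree (n + a)}"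
    using sub by (intro of_nat_mono card_mono) auto
  finally show ?thesis by (simp add: u_def v_def M_def del: of_nat_Suc)
qed

section \<open>Spoiling all n of one scale\<close>

text \<open>The number of greedy steps is \<open>t = 16 M / \<delta>\<close> with
  \<open>M = 4^k\<close>, so at most \<open>exp (-16 M) * card U\<close> values of \<open>n\<close>
  remain. This is below 1 because \<open>card U < 2^(16 M)\<close>, hence none remains.\<close>

lemma ex_squarefree_cover:
  assumes "k \<ge> 3"
  shows "\<exists>S \<subseteq> {a \<in> {2 ^ 4 ^ k<..2 ^ 4 ^ Suc k}. squarefree a}.
    card S \<le> 524288 * 16 ^ k * Suc k \<and>
    (\<forall>n \<in> {2 ^ 4 ^ Suc k<..(2::nat) ^ 4 ^ Suc (Suc k)}. \<exists>a\<in>S. \<not> squarefree (n + a))"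
proof -
  define M :: nat where "M = 4 ^ k"
  define U :: "nat set" where "U = {2 ^ 4 ^ Suc k<..2 ^ 4 ^ Suc (Suc k)}"
  define V :: "nat set" where "V = {a \<in> {2 ^ 4 ^ k<..2 ^ 4 ^ Suc k}. squarefree a}"
  define w where "w = 32768 * real M * real (Suc k)"
  define \<delta> where "\<delta> = 1 / w"
  define t where "t = 524288 * 16 ^ k * Suc k"
  have M: "M \<ge> 1" by (simp add: M_def)
  have "1 \<le> 32768 * M * Suc k" using M by simp
  hence "real 1 \<le> real (32768 * M * Suc k)" by (rule of_nat_mono)
  hence w: "1 \<le> w" by (simp only: of_nat_mult of_nat_numeral of_nat_1 w_def)
  hence \<delta>: "0 \<le> \<delta>" "\<delta> \<le> 1" "\<delta> > 0" by (simp_all add: \<delta>_def)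
  \<comment> \<open>The proportion is taken of all integers up to \<open>2 ^ 4 ^ Suc k\<close>,
    hence holds a fortiori relative to \<open>card V\<close>.\<close>
  have deg: "\<delta> * 2 ^ 4 ^ Suc k \<le> card {a \<in> V. \<not> squarefree (n + a)}"
    if "0 < n" "n \<le> 2 ^ 4 ^ Suc (Suc k)" for n
  proof -
    have "2 ^ (4 * 4 ^ k) / (32768 * 4 ^ k * real (Suc k)) \<le>
       real (card {a \<in> {2 ^ 4 ^ k<..2 ^ (4 * 4 ^ k)}. squarefree a \<and> \<not> squarefree (n + a)})"
      by (rule card_squarefree_nonsquarefree_translate_ge) (use assms that in auto)
    also have "{a \<in> {2 ^ 4 ^ k<..2 ^ (4 * 4 ^ k)}. squarefree a \<and> \<not> squarefree (n + a)} =
      {a \<in> V. \<not> squarefree (n + a)}" by (auto simp: V_def)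
    finally show ?thesis by (simp add: \<delta>_def w_def M_def del: of_nat_Suc)
  qed
  have "V \<subseteq> {0<..2 ^ 4 ^ Suc k}" by (auto simp: V_def)
  from card_mono[OF _ this] have cardV: "card V \<le> 2 ^ 4 ^ Suc k" by simp
  have "\<exists>S\<subseteq>V. card S \<le> t \<and> card {n \<in> U. \<forall>a\<in>S. \<not> \<not> squarefree (n + a)} \<le> (1 - \<delta>) ^ t * card U"
  proof (rule greedy_cover)
    show "finite U" "finite V" by (auto simp: U_def V_def)
    show "V \<noteq> {}"
    proof
      assume "V = {}"
      hence "{a \<in> V. \<not> squarefree (1 + a)} = {}" by blast
      hence "card {a \<in> V. \<not> squarefree (1 + a)} = 0" by (simp only: card.empty)
      moreover have "\<delta> * 2 ^ 4 ^ Suc k \<le> card {a \<in> V. \<not> squarefree (1 + a)}" by (rule deg) auto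
      moreover have "0 < \<delta> * 2 ^ 4 ^ Suc k" using \<delta>(3) by (intro mult_pos_pos) auto
      ultimately show False by linarith
    qed
    fix n assume "n \<in> U"
    have "real (card V) \<le> real (2 ^ 4 ^ Suc k)" using cardV by (rule of_nat_mono)
    hence "real (card V) \<le> 2 ^ 4 ^ Suc k" by (simp only: of_nat_power of_nat_numeral)
    hence "\<delta> * card V \<le> \<delta> * 2 ^ 4 ^ Suc k" using \<delta>(1) by (rule mult_left_mono)
    also have "\<dots> \<le> card {a \<in> V. \<not> squarefree (n + a)}"
      using \<open>n \<in> U\<close> by (intro deg) (auto simp: U_def)
    finally show "\<delta> * card V \<le> card {a \<in> V. \<not> squarefree (n + a)}" .
  qed (use \<delta> in auto)
  then obtain S where S: "S \<subseteq> V" "card S \<le> t"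
    and le: "card {n \<in> U. \<forall>a\<in>S. squarefree (n + a)} \<le> (1 - \<delta>) ^ t * card U" by auto
  have "(16::nat) ^ k = M * M" by (simp add: M_def flip: power_mult_distrib)
  hence "t = 16 * M * (32768 * M * Suc k)" by (simp add: t_def algebra_simps)
  hence "real t = 16 * real M * w"
    by (simp only: of_nat_mult of_nat_numeral w_def)
  hence \<delta>t: "\<delta> * real t = 16 * real M" using w by (simp add: \<delta>_def)
  have "(1 - \<delta>) ^ t \<le> exp (- \<delta>) ^ t"
    using \<delta> exp_ge_add_one_self[of "- \<delta>"] by (intro power_mono) auto
  also have "\<dots> = exp (- (\<delta> * t))" by (simp flip: exp_of_nat_mult add: mult.commute)
  finally have exp1: "(1 - \<delta>) ^ t \<le> exp (- (16 * real M))" by (simp only: \<delta>t)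
  have "card U < 2 ^ 4 ^ Suc (Suc k)" by (simp add: U_def)
  also have "(2::nat) ^ 4 ^ Suc (Suc k) = 2 ^ (16 * M)" by (simp add: M_def)
  finally have "real (card U) < 2 ^ (16 * M)" by (metis of_nat_less_iff of_nat_numeral of_nat_power)
  also have "(2::real) ^ (16 * M) \<le> exp 1 ^ (16 * M)"
    using exp_ge_add_one_self[of 1] by (intro power_mono) auto
  also have "\<dots> = exp (16 * real M)" by (simp flip: exp_of_nat_mult)
  finally have "card U < exp (16 * real M)" .
  hence "exp (- (16 * real M)) * card U < exp (- (16 * real M)) * exp (16 * real M)" by simp
  with mult_right_mono[OF exp1, of "card U"]
  have "(1 - \<delta>) ^ t * card U < exp (- (16 * real M)) * exp (16 * real M)" by linarith
  also have "\<dots> = 1" by (simp flip: exp_add)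
  finally have "card {n \<in> U. \<forall>a\<in>S. squarefree (n + a)} < 1" using le by linarith
  hence "{n \<in> U. \<forall>a\<in>S. squarefree (n + a)} = {}" by (simp add: U_def)
  then show ?thesis using S by (intro exI[of _ S]) (auto simp: U_def V_def t_def)
qed

section \<open>Assembling the sequence and its growth\<close>

lemma admissible_SF:
  assumes "A \<subseteq> SF" shows "admissible A"
  unfolding admissible_def
proof (intro allI impI exI ballI)
  fix p a :: nat assume p: "prime p" and "a \<in> A"
  hence "squarefree a" using assms by (auto simp: SF_def)
  then show "\<not> [a = 0] (mod p\<^sup>2)" using p squarefreeD[of a p] by (auto simp: cong_0_iff)
qed

theorem theorem1p7:
  "\<exists>c::real. c > 0 \<and>
     (\<exists>a :: nat \<Rightarrow> nat.
        strict_mono_on {1..} a \<and>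
        a ` {1..} \<subseteq> SF \<and>
        admissible (a ` {1..}) \<and>
        \<not> property_Q (a ` {1..}) \<and>
        (\<forall>\<^sub>F j in sequentially.
           real (a j) \<ge> exp (c * sqrt (real j) / sqrt (ln (real j)))))"
proof -
  define T where "T k = 524288 * 16 ^ k * Suc k" for k :: nat
  define good where "good k B \<longleftrightarrow> B \<subseteq> {a \<in> {2 ^ 4 ^ k<..2 ^ 4 ^ Suc k}. squarefree a} \<and> card B \<le> T k \<and>
    (\<forall>n \<in> {2 ^ 4 ^ Suc k<..2 ^ 4 ^ Suc (Suc k)}. \<exists>a\<in>B. \<not> squarefree (n + a))" for k :: nat and B :: "nat set"
  have "\<forall>k. \<exists>B. 3 \<le> k \<longrightarrow> good k B"
  proof
    fix k
    show "\<exists>B. 3 \<le> k \<longrightarrow> good k B"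
    proof (cases "3 \<le> k")
      case True
      then have "\<exists>B. good k B" unfolding good_def T_def by (rule ex_squarefree_cover)
      then show ?thesis by blast
    qed auto
  qed
  from choice[OF this] obtain S where good: "\<And>k. 3 \<le> k \<Longrightarrow> good k (S k)" by blast
  have S: "S k \<subseteq> {a \<in> {2 ^ 4 ^ k<..2 ^ 4 ^ Suc k}. squarefree a}" if "k \<ge> 3" for k
    using good[OF that] unfolding good_def by (rule conjunct1)
  have card_S: "card (S k) \<le> T k" if "k \<ge> 3" for k
    using good[OF that] unfolding good_def by (elim conjE)
  have cover: "\<exists>a\<in>S k. \<not> squarefree (n + a)"
    if "k \<ge> 3" "n \<in> {2 ^ 4 ^ Suc k<..2 ^ 4 ^ Suc (Suc k)}" for k n
    using good[OF that(1)] that(2) unfolding good_def by (elim conjE) (rule bspec)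
  define A where "A = (\<Union>k\<in>{3..}. S k)"
  \<comment> \<open>\<open>enumerate\<close> counts from 0 and the sequence from 1, so
    \<open>a 0 = a 1\<close> and strict monotonicity starts at index 1.\<close>
  define a where "a j = enumerate A (j - 1)" for j
  have mono4: "(2::nat) ^ 4 ^ i \<le> 2 ^ 4 ^ k" if "i \<le> k" for i k
    using that by (intro power_increasing) auto
  have S_lower: "2 ^ 4 ^ k < x" "x \<le> 2 ^ 4 ^ Suc k" "squarefree x" if "x \<in> S k" "k \<ge> 3" for x k
    using S[OF that(2)] that(1) by auto
  have inf: "infinite A"
    unfolding infinite_nat_iff_unbounded
  proof
    fix m :: nat
    define k where "k = m + 3"
    \<comment> \<open>An \<open>n\<close> to be spoiled exists at this scale, so \<open>S k\<close>
      cannot be empty.\<close>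
    have "(2::nat) ^ 4 ^ Suc k < 2 ^ 4 ^ Suc (Suc k)" by (intro power_strict_increasing) auto
    with cover[of k "2 ^ 4 ^ Suc (Suc k)"] obtain x where x: "x \<in> S k" by (auto simp: k_def)
    have "k < (4::nat) ^ k" by (rule power_gt_expt) simp
    also have "(4::nat) ^ k < 2 ^ 4 ^ k" by (rule less_exp)
    also have "2 ^ 4 ^ k < x" by (rule S_lower(1)[OF x]) (simp add: k_def)
    finally have "m < x" by (simp add: k_def)
    moreover have "x \<in> A" using x by (auto simp: A_def k_def)
    ultimately show "\<exists>x>m. x \<in> A" by blast
  qed
  have a_A: "a j \<in> A" for j using inf by (simp add: a_def enumerate_in_set)
  have a_mono: "strict_mono_on {1..} a"
  proof (rule strict_mono_onI)
    fix i j :: nat assume "i \<in> {1..}" "j \<in> {1..}" "i < j"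
    then show "a i < a j" unfolding a_def by (intro enumerate_mono inf) auto
  qed
  have range_a: "a ` {1..} = A"
  proof
    show "A \<subseteq> a ` {1..}"
    proof
      fix x assume "x \<in> A"
      from enumerate_Ex[OF inf this] obtain i where "enumerate A i = x" ..
      hence "x = a (Suc i)" by (simp add: a_def)
      then show "x \<in> a ` {1..}" by (rule image_eqI) simp
    qed
    show "a ` {1..} \<subseteq> A" by (rule image_subsetI) (rule a_A)
  qed
  have A_SF: "A \<subseteq> SF"
  proof
    fix x assume "x \<in> A"
    then obtain k where "k \<ge> 3" "x \<in> S k" by (auto simp: A_def)
    then show "x \<in> SF" using S_lower(1,3)[of x k] by (simp add: SF_def)
  qed
  \<comment> \<open>The covers start at \<open>k = 3\<close>, which spoils every \<open>n\<close>
    beyond \<open>2 ^ 4 ^ 4\<close>.\<close>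
  have "{n. \<forall>x\<in>A. x < n \<longrightarrow> n + x \<in> SF} \<subseteq> {..2 ^ 4 ^ 4}"
  proof (intro subsetI, rule ccontr)
    fix n assume "n \<in> {n. \<forall>x\<in>A. x < n \<longrightarrow> n + x \<in> SF}" and n2: "n \<notin> {..2 ^ 4 ^ 4}"
    hence n1: "\<forall>x\<in>A. x < n \<longrightarrow> n + x \<in> SF" by blast
    \<comment> \<open>The least \<open>k\<close> locates \<open>n\<close> between consecutive
      scales; the cover two levels below has all its elements smaller than \<open>n\<close>.\<close>
    define k where "k = (LEAST k. n \<le> 2 ^ 4 ^ k)"
    have "n < (4::nat) ^ n" by (rule power_gt_expt) simp
    also have "(4::nat) ^ n < 2 ^ 4 ^ n" by (rule less_exp)
    finally have ex: "n \<le> 2 ^ 4 ^ n" by simp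
    have k: "n \<le> 2 ^ 4 ^ k" unfolding k_def by (rule LeastI[of "\<lambda>k. n \<le> 2 ^ 4 ^ k", OF ex])
    have k4: "k > 4"
      using n2 k mono4[of k 4] by (metis atMost_iff le_trans not_le)
    define i where "i = k - 2"
    have i: "k = Suc (Suc i)" "i \<ge> 3" using k4 by (auto simp: i_def)
    have "\<not> n \<le> 2 ^ 4 ^ Suc i" using not_less_Least[of "Suc i" "\<lambda>k. n \<le> 2 ^ 4 ^ k"] i
      unfolding k_def by auto
    with cover[of i n] k i obtain x where x: "x \<in> S i" "\<not> squarefree (n + x)" by auto
    have "x < n" using S_lower(2)[OF x(1)] i \<open>\<not> n \<le> 2 ^ 4 ^ Suc i\<close> by linarith
    moreover have "x \<in> A" using x i by (auto simp: A_def)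
    ultimately show False using n1 x by (auto simp: SF_def)
  qed
  hence not_Q: "\<not> property_Q A"
    unfolding property_Q_def using finite_subset by blast
  \<comment> \<open>\<open>T\<close> at least doubles at each step, so its last term dominates the
    sum.\<close>
  have sum_T: "(\<Sum>i\<le>k. T i) \<le> 2 * T k" for k
  proof (induction k)
    case (Suc k)
    have "2 * T k \<le> T (Suc k)" by (simp add: T_def algebra_simps)
    with Suc show ?case by simp
  qed simp
  \<comment> \<open>If \<open>a j\<close> lies in \<open>S k\<close>, the first \<open>j\<close>
    terms all lie in \<open>S 3\<close>, ..., \<open>S k\<close>; \<open>1048576\<close> is twice
    the constant in \<open>T\<close>.\<close>
  have count: "\<exists>k. j \<le> 1048576 * 16 ^ k * Suc k \<and> k \<ge> 3 \<and> 2 ^ 4 ^ k \<le> a j" if j: "j \<ge> 1" for j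
  proof -
    obtain k where k: "k \<ge> 3" "a j \<in> S k" using a_A[of j] by (auto simp: A_def)
    have fin: "finite (\<Union>i\<in>{3..k}. S i)"
      using S finite_subset[OF S] by (intro finite_UN_I) auto
    have "a ` {1..j} \<subseteq> (\<Union>i\<in>{3..k}. S i)"
    proof clarify
      fix l assume l: "l \<in> {1..j}"
      have "l - 1 \<le> j - 1" using l by auto
      hence "a l \<le> a j" using inf by (simp add: a_def)
      obtain i where i: "i \<ge> 3" "a l \<in> S i" using a_A[of l] by (auto simp: A_def)
      have "i \<le> k"
      proof (rule ccontr)
        assume "\<not> i \<le> k"
        hence "(2::nat) ^ 4 ^ Suc k \<le> 2 ^ 4 ^ i" by (intro mono4) auto
        then show False using S_lower(1)[OF i(2,1)] S_lower(2)[OF k(2,1)] \<open>a l \<le> a j\<close> by linarith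
      qed
      then show "a l \<in> (\<Union>i\<in>{3..k}. S i)" using i by auto
    qed
    hence "card (a ` {1..j}) \<le> card (\<Union>i\<in>{3..k}. S i)" by (intro card_mono fin)
    moreover have "inj_on a {1..j}"
      using a_mono by (rule inj_on_subset[OF strict_mono_on_imp_inj_on]) auto
    ultimately have "j \<le> card (\<Union>i\<in>{3..k}. S i)" by (simp add: card_image)
    also have "\<dots> \<le> (\<Sum>i\<in>{3..k}. card (S i))" by (rule card_UN_le) simp
    also have "\<dots> \<le> (\<Sum>i\<in>{3..k}. T i)" by (intro sum_mono card_S) auto
    also have "\<dots> \<le> (\<Sum>i\<le>k. T i)" by (intro sum_mono2) auto
    also have "\<dots> \<le> 2 * T k" by (rule sum_T)
    finally have "j \<le> 1048576 * 16 ^ k * Suc k" by (simp add: T_def)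
    then show ?thesis using k S_lower(1)[OF k(2,1)] by (intro exI[of _ k]) auto
  qed
  have ln2: "1/2 \<le> ln (2::real)" using ln_le_minus_one[of "1/2"] by (simp add: ln_div)
  \<comment> \<open>In \<open>1/2048\<close>, the square root of \<open>1048576\<close> gives 1024
    and the bound \<open>1/2 <= ln 2\<close> a further 2.\<close>
  have growth: "exp (1/2048 * sqrt (real j) / sqrt (ln (real j))) \<le> a j" if j: "j \<ge> 3" for j
  proof -
    obtain k where k: "j \<le> 1048576 * 16 ^ k * Suc k" "k \<ge> 3" "2 ^ 4 ^ k \<le> a j"
      using count[of j] j by auto
    have "exp 1 \<le> real j" using exp_le j by linarith
    hence ln1: "ln (real j) \<ge> 1" using j by (simp add: ln_ge_iff)
    \<comment> \<open>The factor \<open>Suc k\<close> is traded for \<open>ln j\<close>: if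
      \<open>j > 16^k\<close>, then \<open>ln j >= 4 k ln 2 >= 2 k >= k + 1\<close>; otherwise
      \<open>ln j >= 1\<close> is enough.\<close>
    have "real j \<le> 1048576 * 16 ^ k * ln (real j)"
    proof (cases "j \<le> 16 ^ k")
      case True
      hence "real j \<le> 16 ^ k" by (metis of_nat_le_iff of_nat_numeral of_nat_power)
      also have "\<dots> \<le> 1048576 * 16 ^ k * 1" by simp
      also have "\<dots> \<le> 1048576 * 16 ^ k * ln (real j)" using ln1 by (intro mult_left_mono) auto
      finally show ?thesis .
    next
      case False
      hence "16 ^ k \<le> real j" by (metis nat_le_linear of_nat_le_iff of_nat_numeral of_nat_power)
      hence "ln (16 ^ k) \<le> ln (real j)" using j by (subst ln_le_cancel_iff) auto
      moreover have "ln (16 ^ k :: real) = k * (4 * ln 2)"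
        using ln_realpow[of "2::real" 4] by (simp add: ln_realpow)
      moreover have "real k * 2 \<le> k * (4 * ln 2)"
        using ln2 by (intro mult_left_mono) auto
      moreover have "real (Suc k) \<le> real k * 2" using k(2) by simp
      ultimately have "Suc k \<le> ln (real j)" by linarith
      hence "1048576 * 16 ^ k * real (Suc k) \<le> 1048576 * 16 ^ k * ln (real j)"
        by (intro mult_left_mono) auto
      moreover have "real j \<le> real (1048576 * 16 ^ k * Suc k)" using k(1) by (rule of_nat_mono)
      ultimately show ?thesis by (simp only: of_nat_mult of_nat_power of_nat_numeral)
    qed
    hence "sqrt (real j) \<le> sqrt (1048576 * 16 ^ k * ln (real j))" by simp
    also have "\<dots> = 1024 * 4 ^ k * sqrt (ln (real j))"
      by (simp add: real_sqrt_mult real_sqrt_power)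
    finally have "sqrt (real j) / sqrt (ln (real j)) \<le> 1024 * 4 ^ k"
      using ln1 by (simp add: divide_le_eq)
    hence "1/2048 * sqrt (real j) / sqrt (ln (real j)) \<le> 4 ^ k * (1/2)" by simp
    also have "\<dots> \<le> 4 ^ k * ln 2" using ln2 by (intro mult_left_mono) auto
    also have "\<dots> = ln (2 ^ 4 ^ k)" by (simp add: ln_realpow)
    finally have "exp (1/2048 * sqrt (real j) / sqrt (ln (real j))) \<le> exp (ln (2 ^ 4 ^ k))"
      by (simp only: exp_le_cancel_iff)
    also have "\<dots> = real (2 ^ 4 ^ k)" by simp
    also have "\<dots> \<le> a j" using k(3) by (rule of_nat_mono)
    finally show ?thesis .
  qed
  have "\<forall>\<^sub>F j in sequentially. real (a j) \<ge> exp (1/2048 * sqrt (real j) / sqrt (ln (real j)))"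
    using eventually_ge_at_top[of 3] by (rule eventually_mono) (rule growth)
  then show ?thesis
    using a_mono range_a A_SF admissible_SF[OF A_SF] not_Q
    by (intro exI[of _ "1/2048"] conjI exI[of _ a]) auto
qed

end
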